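(* Let $n\ge1$ and $S,T\subseteq[n]$ with $S\le T$ in the type $C_n$ Gale order, and suppose $\Delta[S,T]$ is linked, i.e. $\dim P(\Delta[S,T])=n$. Then \[P(\Delta[S,T])=\bigcup_{\substack{R\subseteq[n]\\ S\le R\le T\setminus\{n\}}} P(\Delta[R,R\cup\{n\}]),\] and these polytopes form a polytope subdivision of $P(\Delta[S,T])$ (any two of them intersect in a face of both). Moreover each $\Delta[R,R\cup\{n\}]$ appearing is the lattice path delta matroid $\Delta[p,q]$ of a linked symmetric snake path $[p,q]$.
   Context: Type $C_n$ Gale order on subsets of $[n]$: for $A=\{a_1<\dots<a_j\}$, $B=\{b_1<\dots<b_k\}$, $A\le B$ iff $j\le k$ and $a_{j-i+1}\le b_{k-i+1}$ for all $i\in[j]$. For $S\le T$, $\Delta[S,T]$ is the delta matroid on $[n]$ with feasible sets all $R$ with $S\le R\le T$; $P(\Delta[S,T])=\operatorname{conv}\{e_R: R\text{ feasible}\}\subseteq\mathbb{R}^n$, $e_R=\sum_{i\in R}e_i$. An $n$-symmetric lattice path is a path from $(0,0)$ to $(n,n)$ of $2n$ unit steps $E=(1,0)$, $N=(0,1)$, written as a word $\alpha_1\cdots\alpha_{2n}$, which is invariant under reflection through the line $y=n-x$ (i.e. $\alpha_i\ne\alpha_{2n-i+1}$ for $i\le n$). For such paths $p\le q$ means $p$ lies weakly below $q$. The label $\operatorname{lab}^L(p)$ is obtained by labelling the steps in order by $-n,-(n-1),\dots,-1,1,\dots,n$ and recording the labels of the $E$ steps; $\Delta[p,q]$ is the delta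 matroid on $[n]$ with feasible sets $\operatorname{lab}^L(r)\cap[n]$ for symmetric $r$ with $p\le r\le q$. The interval $[p,q]$ is a symmetric snake path if the skew diagram (union of unit boxes) between $p$ and $q$ contains no $2\times 2$ square of boxes, and it is linked if $p$ and $q$ meet only at $(0,0)$ and $(n,n)$. *)

theory Defs
  imports "HOL-Analysis.Analysis"
begin

section \<open>Type C Gale order and the set systems it defines\<close>

text \<open>The order compares the \<open>i\<close>-th largest elements. The lists below are indexed
  from 0, so the \<open>i\<close>-th largest element of \<open>A\<close> sits at position \<open>card A - i\<close>.
  Only meaningful for finite sets.\<close>

definition gale_le :: "nat set \<Rightarrow> nat set \<Rightarrow> bool" where
  "gale_le A B \<longleftrightarrow> card A \<le> card B \<and>
     (\<forall>i\<in>{1..card A}. sorted_list_of_set A ! (card A - i) \<le> sorted_list_of_set B ! (card B - i))"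

text \<open>A delta matroid is recorded as the pair of its ground set and its collection of
  feasible sets.\<close>

type_synonym set_system = "nat set \<times> nat set set"

definition ground :: "set_system \<Rightarrow> nat set" where
  "ground D = fst D"

definition feasible :: "set_system \<Rightarrow> nat set set" where
  "feasible D = snd D"

definition gale_delta :: "nat \<Rightarrow> nat set \<Rightarrow> nat set \<Rightarrow> set_system" where
  "gale_delta n S T = ({1..n}, {R. R \<subseteq> {1..n} \<and> gale_le S R \<and> gale_le R T})"


section \<open>Polytopes\<close>

text \<open>The space of real \<open>n\<close>-tuples is \<^typ>\<open>real ^ 'n\<close>, where a bijection \<open>idx\<close> from
  the index type onto \<open>{1..n}\<close> says which coordinate is the \<open>i\<close>-th one.\<close>

definition indicator_vec :: "('n::finite \<Rightarrow> nat) \<Rightarrow> nat set \<Rightarrow> real ^ 'n" where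
  "indicator_vec idx R = (\<Sum>i\<in>{i. idx i \<in> R}. axis i 1)"

definition feasible_polytope :: "('n::finite \<Rightarrow> nat) \<Rightarrow> set_system \<Rightarrow> (real ^ 'n) set" where
  "feasible_polytope idx D = convex hull (indicator_vec idx ` feasible D)"

definition linked_delta :: "('n::finite \<Rightarrow> nat) \<Rightarrow> set_system \<Rightarrow> bool" where
  "linked_delta idx D \<longleftrightarrow> aff_dim (feasible_polytope idx D) = int (card (ground D))"

text \<open>\<open>\<F>\<close> lists the cells of the subdivision, not all of their faces. The empty set
  counts as a face.\<close>

definition polytope_subdivision :: "(real ^ 'n) set \<Rightarrow> (real ^ 'n) set set \<Rightarrow> bool" where
  "polytope_subdivision P \<F> \<longleftrightarrow>
     finite \<F> \<and> (\<forall>X\<in>\<F>. polytope X) \<and> \<Union>\<F> = P \<and>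
     (\<forall>X\<in>\<F>. \<forall>Y\<in>\<F>. (X \<inter> Y) face_of X \<and> (X \<inter> Y) face_of Y)"


section \<open>Symmetric lattice paths\<close>

datatype step = East | North

type_synonym lattice_path = "step list"

definition point_after :: "lattice_path \<Rightarrow> nat \<Rightarrow> nat \<times> nat" where
  "point_after p k = (count_list (take k p) East, count_list (take k p) North)"

definition path_points :: "lattice_path \<Rightarrow> (nat \<times> nat) set" where
  "path_points p = point_after p ` {0..length p}"

text \<open>With steps numbered from 0, the mirror image of step \<open>i\<close> in the line \<open>y = n - x\<close>
  is step \<open>2 * n - 1 - i\<close>, and the reflection exchanges the two directions.\<close>

definition symmetric_path :: "nat \<Rightarrow> lattice_path \<Rightarrow> bool" where
  "symmetric_path n p \<longleftrightarrow>
     length p = 2 * n \<and> point_after p (2 * n) = (n, n) \<and>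
     (\<forall>i<n. p ! i \<noteq> p ! (2 * n - 1 - i))"

definition path_le :: "lattice_path \<Rightarrow> lattice_path \<Rightarrow> bool" where
  "path_le p q \<longleftrightarrow> (\<forall>(x, y)\<in>path_points p. \<exists>y'\<ge>y. (x, y') \<in> path_points q)"

text \<open>The successive labels are \<open>-n, \<dots>, -1, 1, \<dots>, n\<close>; the label 0 is skipped.\<close>

definition step_label :: "nat \<Rightarrow> nat \<Rightarrow> int" where
  "step_label n k = (if k < n then int k - int n else int k - int n + 1)"

definition labL :: "nat \<Rightarrow> lattice_path \<Rightarrow> int set" where
  "labL n p = {step_label n k | k. k < length p \<and> p ! k = East}"

definition path_delta :: "nat \<Rightarrow> lattice_path \<Rightarrow> lattice_path \<Rightarrow> set_system" where
  "path_delta n p q =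
     ({1..n}, {{i\<in>{1..n}. int i \<in> labL n r} | r. symmetric_path n r \<and> path_le p r \<and> path_le r q})"

definition east_step_from :: "lattice_path \<Rightarrow> nat \<times> nat \<Rightarrow> bool" where
  "east_step_from p v \<longleftrightarrow> (\<exists>k<length p. p ! k = East \<and> point_after p k = v)"

text \<open>The unit box with lower left corner \<open>(a, b)\<close> is recorded as \<open>(a, b)\<close>. It lies between
  the paths iff in column \<open>a\<close> the East step of \<open>p\<close> runs weakly below its bottom edge and
  that of \<open>q\<close> weakly above its top edge.\<close>

definition skew_diagram :: "lattice_path \<Rightarrow> lattice_path \<Rightarrow> (nat \<times> nat) set" where
  "skew_diagram p q =
     {(a, b). \<exists>h h'. east_step_from p (a, h) \<and> east_step_from q (a, h') \<and> h \<le> b \<and> b + 1 \<le> h'}"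

definition symmetric_snake :: "nat \<Rightarrow> lattice_path \<Rightarrow> lattice_path \<Rightarrow> bool" where
  "symmetric_snake n p q \<longleftrightarrow>
     symmetric_path n p \<and> symmetric_path n q \<and> path_le p q \<and>
     \<not> (\<exists>a b. {(a, b), (a + 1, b), (a, b + 1), (a + 1, b + 1)} \<subseteq> skew_diagram p q)"

text \<open>Two such paths always meet at lattice points, so it suffices to look at these.\<close>

definition linked_paths :: "nat \<Rightarrow> lattice_path \<Rightarrow> lattice_path \<Rightarrow> bool" where
  "linked_paths n p q \<longleftrightarrow> path_points p \<inter> path_points q = {(0, 0), (n, n)}"

end

theory Submission
  imports Defs
begin

text \<open>In the coordinates \<open>y\<^sub>k = x\<^sub>k + \<dots> + x\<^sub>n\<close> the type C Gale order becomes the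
  componentwise order on the vectors \<open>y\<close> of sets, and \<open>P(\<Delta>[S, T])\<close> is cut out of the region
  \<open>0 \<le> y\<^sub>k - y\<^sub>k\<^sub>+\<^sub>1 \<le> 1\<close> by the box \<open>[y(S), y(T)]\<close>: at an extreme point no fractional value
  can occur among the \<open>y\<^sub>k\<close>, since the class of all coordinates with a given fractional part could be moved up and down
  simultaneously. The polytopes \<open>P(\<Delta>[R, R \<union> {n}])\<close> are the pieces of that region lying in the
  integer unit cubes, which makes the covering and the intersection property evident. A symmetric
  path is likewise determined by the vector \<open>y\<close> of its label set, so \<open>R\<close> and \<open>R \<union> {n}\<close> give
  two paths that differ by exactly one diagonal step strictly between their end points.\<close>

section \<open>Tail counts\<close>

text \<open>This is the coordinate \<open>y\<^sub>k\<close> of the vertex belonging to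
  \<open>A\<close>, kept as a natural number.\<close>

definition tail_card :: "nat set \<Rightarrow> nat \<Rightarrow> nat" where
  "tail_card A k = card (A \<inter> {k..})"

text \<open>The last \<open>i\<close> positions of the sorted list hold the \<open>i\<close> largest
  elements. If the smallest of them is at least \<open>k\<close>, all of them lie in the tail;
  otherwise the tail fits into the last \<open>i - 1\<close> positions.\<close>

lemma sorted_list_of_set_nth_ge_iff:
  fixes A :: "nat set"
  assumes fin: "finite A" and i: "1 \<le> i" "i \<le> card A"
  shows "k \<le> sorted_list_of_set A ! (card A - i) \<longleftrightarrow> i \<le> tail_card A k"
proof -
  define xs where "xs = sorted_list_of_set A"
  have len: "length xs = card A" and set: "set xs = A" and dist: "distinct xs" and sorted: "sorted xs"
    using fin by (simp_all add: xs_def)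
  have inj: "inj_on ((!) xs) B" if "B \<subseteq> {..<card A}" for B
    using that by (intro inj_on_nth dist) (auto simp only: len)
  show ?thesis
  proof
    assume k: "k \<le> sorted_list_of_set A ! (card A - i)"
    have "(!) xs ` {card A - i..<card A} \<subseteq> A \<inter> {k..}"
    proof (rule image_subsetI)
      fix j assume "j \<in> {card A - i..<card A}"
      then have j: "card A - i \<le> j" "j < length xs" using len by auto
      have "xs ! (card A - i) \<le> xs ! j" by (rule sorted_nth_mono[OF sorted j])
      moreover have "xs ! j \<in> A" using nth_mem[OF j(2)] unfolding set .
      ultimately show "xs ! j \<in> A \<inter> {k..}" using k by (simp add: xs_def)
    qed
    then have "card ((!) xs ` {card A - i..<card A}) \<le> tail_card A k"
      unfolding tail_card_def using fin by (intro card_mono) auto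
    moreover have "card ((!) xs ` {card A - i..<card A}) = i"
      using i by (subst card_image[OF inj]) auto
    ultimately show "i \<le> tail_card A k" by simp
  next
    assume i': "i \<le> tail_card A k"
    show "k \<le> sorted_list_of_set A ! (card A - i)"
    proof (rule ccontr)
      assume n: "\<not> k \<le> sorted_list_of_set A ! (card A - i)"
      have "A \<inter> {k..} \<subseteq> (!) xs ` {card A - i<..<card A}"
      proof
        fix a assume a: "a \<in> A \<inter> {k..}"
        then obtain j where j: "j < card A" "a = xs ! j"
          by (metis IntD1 in_set_conv_nth len set)
        have "card A - i < j"
          using sorted_nth_mono[OF sorted, of j "card A - i"] n a j i len by (fastforce simp: xs_def)
        then show "a \<in> (!) xs ` {card A - i<..<card A}" using j by auto
      qed
      then have "tail_card A k \<le> card ((!) xs ` {card A - i<..<card A})"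
        unfolding tail_card_def by (intro card_mono) auto
      also have "\<dots> = i - 1"
        using i by (subst card_image[OF inj]) auto
      finally show False using i i' by simp
    qed
  qed
qed

lemma tail_card_le_card: "finite A \<Longrightarrow> tail_card A k \<le> card A"
  unfolding tail_card_def by (intro card_mono) auto

text \<open>From left to right, \<open>i\<close> is the tail count of \<open>A\<close> at
  \<open>k\<close>; from right to left, \<open>k\<close> is the \<open>i\<close>-th largest element
  of \<open>A\<close>. The value \<open>k = 0\<close> supplies the comparison of
  cardinalities.\<close>

lemma gale_le_iff_tail_card:
  assumes "finite A" "finite B"
  shows "gale_le A B \<longleftrightarrow> (\<forall>k. tail_card A k \<le> tail_card B k)"
proof
  assume le: "gale_le A B"
  show "\<forall>k. tail_card A k \<le> tail_card B k"
  proof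
    fix k
    show "tail_card A k \<le> tail_card B k"
    proof (cases "tail_card A k = 0")
      case False
      define i where "i = tail_card A k"
      have i: "1 \<le> i" "i \<le> card A" "i \<le> card B"
        using False le tail_card_le_card[OF assms(1), of k] by (auto simp: i_def gale_le_def)
      have "k \<le> sorted_list_of_set A ! (card A - i)"
        using sorted_list_of_set_nth_ge_iff[OF assms(1) i(1,2)] i_def by simp
      also have "\<dots> \<le> sorted_list_of_set B ! (card B - i)"
        using le i by (simp add: gale_le_def)
      finally show ?thesis
        using sorted_list_of_set_nth_ge_iff[OF assms(2) i(1,3)] i_def by simp
    qed simp
  qed
next
  assume le: "\<forall>k. tail_card A k \<le> tail_card B k"
  have card: "card A \<le> card B" using le[rule_format, of 0] by (simp add: tail_card_def)
  show "gale_le A B"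
    unfolding gale_le_def
  proof (intro conjI ballI card)
    fix i assume "i \<in> {1..card A}"
    then have i: "1 \<le> i" "i \<le> card A" "i \<le> card B" using card by auto
    show "sorted_list_of_set A ! (card A - i) \<le> sorted_list_of_set B ! (card B - i)"
      using sorted_list_of_set_nth_ge_iff[OF assms(1) i(1,2)]
        sorted_list_of_set_nth_ge_iff[OF assms(2) i(1,3)] le order_trans by blast
  qed
qed

lemma tail_card_Suc:
  "finite A \<Longrightarrow> tail_card A k = of_bool (k \<in> A) + tail_card A (Suc k)"
proof -
  assume fin: "finite A"
  have "A \<inter> {k..} = (if k \<in> A then insert k (A \<inter> {Suc k..}) else A \<inter> {Suc k..})"
    by (auto simp: Suc_le_eq le_less)
  then show ?thesis using fin by (simp add: tail_card_def)
qed

lemma tail_card_eq_0: "A \<subseteq> {1..n} \<Longrightarrow> n < k \<Longrightarrow> tail_card A k = 0"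
proof -
  assume "A \<subseteq> {1..n}" "n < k"
  then have "A \<inter> {k..} = {}" by auto
  then show ?thesis by (simp add: tail_card_def)
qed

text \<open>Counts beyond \<open>n\<close> vanish, and those at 0 and 1 agree because 0 lies in
  neither set.\<close>

lemma gale_le_iff_tail_card_on:
  assumes A: "A \<subseteq> {1..n}" and B: "B \<subseteq> {1..n}"
  shows "gale_le A B \<longleftrightarrow> (\<forall>k\<in>{1..n}. tail_card A k \<le> tail_card B k)"
proof -
  have fin: "finite A" "finite B" using A B finite_subset by blast+
  have "0 \<notin> A" "0 \<notin> B" using A B by auto
  then have z: "tail_card A 0 = tail_card A 1" "tail_card B 0 = tail_card B 1"
    using tail_card_Suc[OF fin(1), of 0] tail_card_Suc[OF fin(2), of 0] by simp_all
  have "tail_card A k \<le> tail_card B k" if "\<forall>k\<in>{1..n}. tail_card A k \<le> tail_card B k" for k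
  proof (cases "n < k")
    case True
    then show ?thesis by (simp add: tail_card_eq_0[OF A])
  next
    case False
    show ?thesis
    proof (cases "n = 0")
      case True
      then show ?thesis using A by (simp add: tail_card_def)
    next
      case n: False
      have "tail_card A (max 1 k) \<le> tail_card B (max 1 k)" using that False n by simp
      then show ?thesis using z by (cases "k = 0") simp_all
    qed
  qed
  then show ?thesis using gale_le_iff_tail_card[OF fin] by blast
qed

text \<open>This is why \<open>R\<close> is paired with \<open>R \<union> {n}\<close>: the new
  element is counted in every tail up to \<open>n\<close>, so the interval between the two sets
  becomes an integer unit cube.\<close>

lemma tail_card_insert_top:
  assumes R: "R \<subseteq> {1..n}" and "n \<notin> R" and "k \<le> n"
  shows "tail_card (R \<union> {n}) k = tail_card R k + 1"
proof -
  have "finite R" using R finite_subset by blast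
  moreover have "(R \<union> {n}) \<inter> {k..} = insert n (R \<inter> {k..})" using assms by auto
  ultimately show ?thesis using assms by (simp add: tail_card_def)
qed

text \<open>The elements of \<open>R\<close> are the places where \<open>f\<close> drops by one, and
  adding up the drops downwards from \<open>Suc n\<close> recovers \<open>f\<close>. Integer values
  let \<open>f\<close> be built from floors.\<close>

lemma ex_set_with_tail_cards:
  fixes f :: "nat \<Rightarrow> int"
  assumes "f (Suc n) = 0" and "\<And>k. k \<in> {1..n} \<Longrightarrow> f k - f (Suc k) \<in> {0, 1}"
  obtains R where "R \<subseteq> {1..n}" "\<And>k. k \<in> {1..Suc n} \<Longrightarrow> int (tail_card R k) = f k"
proof
  let ?R = "{k\<in>{1..n}. f k - f (Suc k) = 1}"
  show "?R \<subseteq> {1..n}" by auto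
  show "int (tail_card ?R k) = f k" if "k \<in> {1..Suc n}" for k
  proof -
    from that have "k \<le> Suc n" by simp
    then show ?thesis using that
    proof (induction rule: inc_induct)
      case base
      have "tail_card ?R (Suc n) = 0" by (rule tail_card_eq_0[of _ n]) auto
      then show ?case using assms(1) by simp
    next
      case (step m)
      have "int (tail_card ?R m) = of_bool (m \<in> ?R) + f (Suc m)"
        using step tail_card_Suc[of ?R m] by simp
      also have "\<dots> = f m" using assms(2)[of m] step.hyps that by auto
      finally show ?case .
    qed
  qed
qed

section \<open>Polytopes given by tail sums\<close>

text \<open>The linear change of coordinates from \<open>x\<close> to \<open>y\<close>, with
  positions read off through \<open>idx\<close> because vectors are indexed by a type.\<close>

definition tail_sum :: "('n::finite \<Rightarrow> nat) \<Rightarrow> nat \<Rightarrow> real ^ 'n \<Rightarrow> real" where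
  "tail_sum idx k x = (\<Sum>i\<in>{i. k \<le> idx i}. x $ i)"

lemma linear_tail_sum: "linear (tail_sum idx k)"
  by (auto simp: linear_iff tail_sum_def sum.distrib sum_distrib_left)

lemma tail_sum_Suc:
  assumes "inj idx"
  shows "tail_sum idx (idx i) x = x $ i + tail_sum idx (Suc (idx i)) x"
proof -
  have "{j. idx i \<le> idx j} = insert i {j. Suc (idx i) \<le> idx j}"
    using assms by (auto simp: inj_def Suc_le_eq le_less)
  then show ?thesis by (simp add: tail_sum_def)
qed

lemma tail_sum_eq_0: "range idx \<subseteq> {1..n} \<Longrightarrow> n < k \<Longrightarrow> tail_sum idx k x = 0"
proof -
  assume "range idx \<subseteq> {1..n}" "n < k"
  then have "{i. k \<le> idx i} = {}" by (simp add: image_subset_iff) (meson le_trans not_le)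
  then show ?thesis by (simp add: tail_sum_def)
qed

lemma indicator_vec_nth: "indicator_vec idx R $ i = of_bool (idx i \<in> R)"
  unfolding indicator_vec_def by (simp add: axis_def of_bool_def)

lemma tail_sum_indicator_vec:
  assumes idx: "bij_betw idx UNIV {1..n}" and R: "R \<subseteq> {1..n}"
  shows "tail_sum idx k (indicator_vec idx R) = tail_card R k"
proof -
  have "bij_betw idx {i. k \<le> idx i \<and> idx i \<in> R} (R \<inter> {k..})"
    using idx R by (auto simp: bij_betw_def inj_on_def)
  then have "card {i. k \<le> idx i \<and> idx i \<in> R} = tail_card R k"
    unfolding tail_card_def by (rule bij_betw_same_card)
  then show ?thesis
    by (simp add: tail_sum_def indicator_vec_nth of_bool_def sum.If_cases Int_def)
qed

text \<open>The bounds take natural numbers as values, which is what makes the vertices integral.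
  Only their values on the range of \<open>idx\<close> matter.\<close>

definition tail_polytope :: "('n::finite \<Rightarrow> nat) \<Rightarrow> (nat \<Rightarrow> nat) \<Rightarrow> (nat \<Rightarrow> nat) \<Rightarrow> (real ^ 'n) set" where
  "tail_polytope idx l u =
     {x. \<forall>i. x $ i \<in> {0..1} \<and> tail_sum idx (idx i) x \<in> {real (l (idx i))..real (u (idx i))}}"

lemma tail_polytope_eq_Inter:
  "tail_polytope idx l u =
    (\<Inter>i. (\<lambda>x. x $ i) -` {0..1} \<inter> tail_sum idx (idx i) -` {real (l (idx i))..real (u (idx i))})"
  unfolding tail_polytope_def by blast

lemma convex_tail_polytope: "convex (tail_polytope idx l u)"
proof -
  have "linear (\<lambda>x :: real ^ 'a. x $ i)" for i
    by (simp add: linear_iff)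
  then show ?thesis
    unfolding tail_polytope_eq_Inter
    by (intro convex_INT convex_Int convex_linear_vimage linear_tail_sum convex_real_interval)
qed

lemma compact_tail_polytope: "compact (tail_polytope idx l u)"
proof -
  have "continuous_on UNIV (tail_sum idx k)" for k :: nat and idx :: "'a \<Rightarrow> nat"
    by (simp add: linear_continuous_on linear_linear linear_tail_sum)
  moreover have "continuous_on UNIV (\<lambda>x :: real ^ 'a. x $ i)" for i
    by (intro continuous_on_component continuous_on_id)
  ultimately have "closed (tail_polytope idx l u)"
    unfolding tail_polytope_eq_Inter
    by (intro closed_INT ballI closed_Int closed_vimage closed_real_atLeastAtMost)
  moreover have "tail_polytope idx l u \<subseteq> cbox 0 1"
    unfolding tail_polytope_def mem_box_cart subset_iff mem_Collect_eq by simp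
  ultimately show ?thesis
    unfolding compact_eq_bounded_closed using bounded_subset[OF bounded_cbox] by blast
qed

section \<open>Integrality of the extreme points\<close>

lemma eventually_perturb_le:
  fixes a b c :: real
  assumes le: "a \<le> b" and neq: "c \<noteq> 0 \<Longrightarrow> a \<noteq> b"
  shows "eventually (\<lambda>e. a \<le> b + e * c) (at_right 0)"
proof (cases "c = 0")
  case True
  show ?thesis unfolding True using le by simp
next
  case False
  have "a < b + 0 * c" using le neq[OF False] by simp
  moreover have "((\<lambda>e. b + e * c) \<longlongrightarrow> b + 0 * c) (at_right 0)"
    by (rule tendsto_add[OF tendsto_const tendsto_mult[OF tendsto_ident_at tendsto_const]])
  ultimately have "eventually (\<lambda>e. a < b + e * c) (at_right 0)"
    by (rule order_tendstoD(1)[rotated])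
  then show ?thesis by (rule eventually_mono) (rule less_imp_le)
qed

text \<open>A constraint that is not tight survives a small move, and a tight one is not moved at
  all. Finiteness of the index type gives one range of \<open>e\<close> for all constraints.\<close>

lemma eventually_perturb_in_interval:
  fixes b c :: "'i::finite \<Rightarrow> real"
  assumes "\<And>i. b i \<in> {lo i..hi i}" "\<And>i. c i \<noteq> 0 \<Longrightarrow> b i \<noteq> lo i \<and> b i \<noteq> hi i"
  shows "eventually (\<lambda>e. \<forall>i. b i + e * c i \<in> {lo i..hi i} \<and> b i - e * c i \<in> {lo i..hi i}) (at_right 0)"
proof -
  have "eventually (\<lambda>e. b i + e * c i \<in> {lo i..hi i} \<and> b i - e * c i \<in> {lo i..hi i}) (at_right 0)" for i
  proof -
    \<comment> \<open>Upper bounds become lower bounds after negation, so the same one-sided fact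
      serves all four cases.\<close>
    have "eventually (\<lambda>e. lo i \<le> b i + e * c i) (at_right 0)"
      "eventually (\<lambda>e. lo i \<le> b i + e * - c i) (at_right 0)"
      "eventually (\<lambda>e. - hi i \<le> - b i + e * c i) (at_right 0)"
      "eventually (\<lambda>e. - hi i \<le> - b i + e * - c i) (at_right 0)"
      by (rule eventually_perturb_le; use assms[of i] in auto)+
    then show ?thesis by eventually_elim auto
  qed
  then show ?thesis by (simp add: eventually_all_finite)
qed

text \<open>Telescoping inverts the change of coordinates: any prescription of tail sums that ends
  in 0 is realised by a vector.\<close>

lemma tail_sum_differences:
  assumes idx: "bij_betw idx UNIV {1..n}" and "D (Suc n) = 0" and k: "k \<in> {1..Suc n}"
  shows "tail_sum idx k (\<chi> i. D (idx i) - D (Suc (idx i))) = D k"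
proof -
  have r: "range idx = {1..n}" "inj idx" using idx by (auto simp: bij_betw_def)
  from k have "k \<le> Suc n" by simp
  then show ?thesis using k
  proof (induction rule: inc_induct)
    case base
    show ?case using assms(2) r by (simp add: tail_sum_eq_0[of idx n])
  next
    case (step m)
    then have "m \<in> range idx" using r(1) by simp
    then obtain i where i: "m = idx i" by blast
    have "tail_sum idx (Suc m) (\<chi> i. D (idx i) - D (Suc (idx i))) = D (Suc m)"
      using step by simp
    then show ?case unfolding i tail_sum_Suc[OF r(2)] by simp
  qed
qed

lemma extreme_point_of_tail_polytope_tail_sum_Ints:
  assumes idx: "bij_betw idx UNIV {1..n}" and ex: "x extreme_point_of tail_polytope idx l u"
    and k: "k \<in> {1..Suc n}"
  shows "tail_sum idx k x \<in> \<int>"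
proof (rule ccontr)
  have r: "range idx = {1..n}" "inj idx" using idx by (auto simp: bij_betw_def)
  assume nonint: "tail_sum idx k x \<notin> \<int>"
  \<comment> \<open>\<open>D\<close> marks the indices whose tail sum has the same fractional part
    as the one at \<open>k\<close>; \<open>d\<close> is the direction that moves exactly these tail
    sums.\<close>
  define D where "D j = (if tail_sum idx j x - tail_sum idx k x \<in> \<int> then 1 else 0 :: real)" for j
  define d where "d = (\<chi> i. D (idx i) - D (Suc (idx i)))"
  \<comment> \<open>The tail sum at \<open>Suc n\<close> is the integer 0, so it lies outside the
    class and the telescoping closes.\<close>
  have "D (Suc n) = 0" using nonint r by (auto simp: D_def tail_sum_eq_0[of idx n])
  then have td: "tail_sum idx j d = D j" if "j \<in> {1..Suc n}" for j
    unfolding d_def using idx that by (intro tail_sum_differences)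
  have idx_in: "idx i \<in> {1..Suc n}" for i using r(1) rangeI[of idx i] by auto
  have x: "x $ i \<in> {0..1}" "tail_sum idx (idx i) x \<in> {real (l (idx i))..real (u (idx i))}" for i
    using ex by (auto simp: extreme_point_of_def tail_polytope_def)
  \<comment> \<open>If \<open>x $ i\<close> is an integer, two consecutive tail sums have the same
    fractional part; they move together and leave \<open>x $ i\<close> fixed.\<close>
  have "d $ i \<noteq> 0 \<Longrightarrow> x $ i \<notin> \<int>" for i
  proof
    assume d: "d $ i \<noteq> 0" and xi: "x $ i \<in> \<int>"
    have "tail_sum idx (idx i) x - tail_sum idx k x = (tail_sum idx (Suc (idx i)) x - tail_sum idx k x) + x $ i"
      using tail_sum_Suc[OF r(2), of i x] by simp
    then have "D (idx i) = D (Suc (idx i))"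
      unfolding D_def using xi by (metis Ints_add Ints_diff add_diff_cancel_right')
    then show False using d by (simp add: d_def)
  qed
  then have "\<forall>\<^sub>F e in at_right 0. \<forall>i. x $ i + e * d $ i \<in> {0..1} \<and> x $ i - e * d $ i \<in> {0..1}"
    by (intro eventually_perturb_in_interval x) (metis Ints_0 Ints_1)
  \<comment> \<open>No member of the class is an integer, so none of them sits at one of the integer
    bounds.\<close>
  moreover have "D j \<noteq> 0 \<Longrightarrow> tail_sum idx j x \<notin> \<int>" for j
    using nonint Ints_diff[of "tail_sum idx j x" "tail_sum idx j x - tail_sum idx k x"]
    by (auto simp: D_def split: if_splits)
  then have "\<forall>\<^sub>F e in at_right 0. \<forall>i.
      tail_sum idx (idx i) x + e * D (idx i) \<in> {real (l (idx i))..real (u (idx i))} \<and>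
      tail_sum idx (idx i) x - e * D (idx i) \<in> {real (l (idx i))..real (u (idx i))}"
    by (intro eventually_perturb_in_interval x) (metis Ints_of_nat)
  moreover have "\<forall>\<^sub>F e in at_right 0. (0::real) < e" by (simp add: eventually_at_right_less)
  ultimately have "\<forall>\<^sub>F e in at_right 0. 0 < e \<and> x + e *\<^sub>R d \<in> tail_polytope idx l u \<and> x - e *\<^sub>R d \<in> tail_polytope idx l u"
    by eventually_elim
      (use idx_in td in \<open>simp add: tail_polytope_def linear_add[OF linear_tail_sum]
        linear_diff[OF linear_tail_sum] linear_cmul[OF linear_tail_sum]\<close>)
  then obtain e where e: "0 < e" "x + e *\<^sub>R d \<in> tail_polytope idx l u" "x - e *\<^sub>R d \<in> tail_polytope idx l u"
    using eventually_happens trivial_limit_at_right_real by blast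
  \<comment> \<open>The index \<open>k\<close> belongs to its own class, so \<open>d\<close> is not
    0 and the two perturbed points differ.\<close>
  have "tail_sum idx k d = 1" using td[OF k] by (simp add: D_def)
  then have "d \<noteq> 0" using linear_0[OF linear_tail_sum, of idx k] by auto
  then have "x + e *\<^sub>R d \<noteq> x - e *\<^sub>R d"
    using e(1) by (simp add: diff_conv_add_uminus eq_neg_iff_add_eq_0 del: add_uminus_conv_diff flip: scaleR_2)
  moreover have "x = midpoint (x + e *\<^sub>R d) (x - e *\<^sub>R d)" by (simp add: midpoint_def flip: scaleR_2)
  ultimately have "x \<in> open_segment (x + e *\<^sub>R d) (x - e *\<^sub>R d)"
    by (metis midpoint_in_open_segment)
  then show False using ex e by (auto simp: extreme_point_of_def)
qed

text \<open>By Krein-Milman it suffices to look at the extreme points. Their tail sums are integers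
  with consecutive differences 0 or 1, hence the tail counts of a set.\<close>

lemma tail_polytope_eq_hull:
  assumes idx: "bij_betw idx UNIV {1..n}"
  shows "tail_polytope idx l u = convex hull (indicator_vec idx `
    {R. R \<subseteq> {1..n} \<and> (\<forall>k\<in>{1..n}. l k \<le> tail_card R k \<and> tail_card R k \<le> u k)})" (is "_ = convex hull ?V")
proof
  have r: "range idx = {1..n}" "inj idx" using idx by (auto simp: bij_betw_def)
  have idx_in: "idx i \<in> {1..n}" for i using r(1) by blast
  have "x \<in> ?V" if ex: "x extreme_point_of tail_polytope idx l u" for x
  proof -
    define f where "f k = \<lfloor>tail_sum idx k x\<rfloor>" for k
    \<comment> \<open>By integrality the floor loses nothing; it only moves the tail sum into the
      integers.\<close>
    have f: "real_of_int (f k) = tail_sum idx k x" if "k \<in> {1..Suc n}" for k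
      using extreme_point_of_tail_polytope_tail_sum_Ints[OF idx ex that] by (simp add: f_def)
    have fx: "real_of_int (f (idx i) - f (Suc (idx i))) = x $ i" for i
      using f[of "idx i"] f[of "Suc (idx i)"] idx_in[of i] tail_sum_Suc[OF r(2), of i x] by simp
    have x: "x $ i \<in> {0..1}" "tail_sum idx (idx i) x \<in> {real (l (idx i))..real (u (idx i))}" for i
      using ex by (auto simp: extreme_point_of_def tail_polytope_def)
    have "f (Suc n) = 0" using r by (simp add: f_def tail_sum_eq_0[of idx n])
    moreover have "f k - f (Suc k) \<in> {0, 1}" if k: "k \<in> {1..n}" for k
    proof -
      obtain i where i: "k = idx i" using k r(1) by blast
      have "0 \<le> real_of_int (f k - f (Suc k))" "real_of_int (f k - f (Suc k)) \<le> 1"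
        using fx[of i] x(1)[of i] i by auto
      then show ?thesis by auto
    qed
    ultimately obtain R where R: "R \<subseteq> {1..n}" "\<And>k. k \<in> {1..Suc n} \<Longrightarrow> int (tail_card R k) = f k"
      using ex_set_with_tail_cards by metis
    have tR: "real (tail_card R k) = tail_sum idx k x" if "k \<in> {1..Suc n}" for k
      using R(2)[OF that] f[OF that] by (metis of_int_of_nat_eq)
    have "x = indicator_vec idx R"
    proof (subst vec_eq_iff, intro allI)
      fix i
      have "finite R" using R finite_subset by blast
      then have "real (tail_card R (idx i)) = of_bool (idx i \<in> R) + tail_card R (Suc (idx i))"
        using tail_card_Suc[of R "idx i"] by simp
      then show "x $ i = indicator_vec idx R $ i"
        using tR[of "idx i"] tR[of "Suc (idx i)"] idx_in[of i] tail_sum_Suc[OF r(2), of i x]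
        by (simp add: indicator_vec_nth)
    qed
    moreover have "l k \<le> tail_card R k \<and> tail_card R k \<le> u k" if k: "k \<in> {1..n}" for k
    proof -
      obtain i where i: "k = idx i" using k r(1) by blast
      show ?thesis using x(2)[of i] tR[of k] k i by auto
    qed
    ultimately show ?thesis using R(1) by blast
  qed
  then have "convex hull {x. x extreme_point_of tail_polytope idx l u} \<subseteq> convex hull ?V"
    by (intro hull_mono) blast
  then show "tail_polytope idx l u \<subseteq> convex hull ?V"
    using Krein_Milman_Minkowski[OF compact_tail_polytope convex_tail_polytope, of idx l u] by simp
  show "convex hull ?V \<subseteq> tail_polytope idx l u"
    using idx_in by (intro hull_minimal convex_tail_polytope)
      (auto simp: tail_polytope_def tail_sum_indicator_vec[OF idx] indicator_vec_nth)
qed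

lemma feasible_polytope_gale_delta:
  assumes idx: "bij_betw idx UNIV {1..n}" and "A \<subseteq> {1..n}" "B \<subseteq> {1..n}"
  shows "feasible_polytope idx (gale_delta n A B) = tail_polytope idx (tail_card A) (tail_card B)"
proof -
  have "feasible (gale_delta n A B) =
    {R. R \<subseteq> {1..n} \<and> (\<forall>k\<in>{1..n}. tail_card A k \<le> tail_card R k \<and> tail_card R k \<le> tail_card B k)}"
    using assms by (auto simp: feasible_def gale_delta_def gale_le_iff_tail_card_on)
  then show ?thesis
    by (simp add: feasible_polytope_def tail_polytope_eq_hull[OF idx])
qed

section \<open>The subdivision into unit cells\<close>

text \<open>A fixed tail sum is a nontrivial linear equation, so \<open>P\<close> lies in a
  hyperplane.\<close>

lemma aff_dim_less_if_tail_sum_const: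
  fixes idx :: "'n::finite \<Rightarrow> nat"
  assumes "P \<subseteq> {x. tail_sum idx (idx i) x = c}"
  shows "aff_dim P < int CARD('n)"
proof -
  \<comment> \<open>The coefficient vector of the tail sum; its entry 1 at \<open>i\<close> shows
    that it is nonzero.\<close>
  define w :: "real ^ 'n" where "w = (\<chi> j. of_bool (idx i \<le> idx j))"
  have "w \<bullet> x = tail_sum idx (idx i) x" for x
  proof -
    have "w \<bullet> x = (\<Sum>j\<in>UNIV. if idx i \<le> idx j then x $ j else 0)"
      unfolding inner_vec_def by (intro sum.cong) (auto simp: w_def)
    also have "\<dots> = tail_sum idx (idx i) x"
      by (simp add: sum.If_cases tail_sum_def)
    finally show ?thesis .
  qed
  then have "P \<subseteq> {x. w \<bullet> x = c}" using assms by simp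
  then have "aff_dim P \<le> aff_dim {x. w \<bullet> x = c}" by (rule aff_dim_subset)
  moreover have "w $ i = 1" by (simp add: w_def)
  then have "w \<noteq> 0" by force
  then have "aff_dim {x. w \<bullet> x = c} = int DIM(real ^ 'n) - 1" by (simp add: aff_dim_hyperplane)
  ultimately show ?thesis by simp
qed

text \<open>Equality at \<open>k\<close> would fix the tail sum at \<open>k\<close> on the whole
  polytope, whose dimension would then drop below \<open>n\<close>.\<close>

lemma linked_delta_tail_card_less:
  fixes idx :: "'n::finite \<Rightarrow> nat"
  assumes idx: "bij_betw idx UNIV {1..n}" and S: "S \<subseteq> {1..n}" and T: "T \<subseteq> {1..n}"
    and le: "gale_le S T" and linked: "linked_delta idx (gale_delta n S T)" and k: "k \<in> {1..n}"
  shows "tail_card S k < tail_card T k"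
proof (rule ccontr)
  assume "\<not> tail_card S k < tail_card T k"
  then have eq: "tail_card S k = tail_card T k"
    using le k gale_le_iff_tail_card_on[OF S T] by (simp add: antisym)
  obtain i where i: "k = idx i" using k idx unfolding bij_betw_def by blast
  have "aff_dim (feasible_polytope idx (gale_delta n S T)) < int CARD('n)"
    unfolding feasible_polytope_gale_delta[OF idx S T]
  proof (rule aff_dim_less_if_tail_sum_const[where idx = idx and i = i and c = "tail_card S k"], rule subsetI)
    fix x assume "x \<in> tail_polytope idx (tail_card S) (tail_card T)"
    then have "tail_sum idx k x \<in> {real (tail_card S k)..real (tail_card T k)}"
      unfolding tail_polytope_def i by blast
    then show "x \<in> {x. tail_sum idx (idx i) x = real (tail_card S k)}"
      unfolding i[symmetric] by (simp add: eq)
  qed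
  moreover have "CARD('n) = n" using bij_betw_same_card[OF idx] by simp
  ultimately show False using linked by (simp add: linked_delta_def ground_def gale_delta_def)
qed

section \<open>Integer unit cells and their common faces\<close>

definition unit_cell :: "('n::finite \<Rightarrow> nat) \<Rightarrow> (nat \<Rightarrow> nat) \<Rightarrow> (real ^ 'n) set" where
  "unit_cell idx l = tail_polytope idx l (\<lambda>k. l k + 1)"

text \<open>Two integer unit intervals are equal, disjoint or share one end point. If an inner point
  of a segment in the first cell has a coordinate at an end point of that cell's interval, so do
  both ends of the segment.\<close>

lemma unit_cell_Int_face: "(unit_cell idx l \<inter> unit_cell idx m) face_of unit_cell idx l"
  unfolding face_of_def
proof (intro conjI ballI impI)
  show "convex (unit_cell idx l \<inter> unit_cell idx m)"
    unfolding unit_cell_def by (intro convex_Int convex_tail_polytope)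
next
  fix a b x
  assume a: "a \<in> unit_cell idx l" and b: "b \<in> unit_cell idx l"
    and x: "x \<in> unit_cell idx l \<inter> unit_cell idx m" and seg: "x \<in> open_segment a b"
  from seg obtain u where u: "0 < u" "u < 1" "x = (1 - u) *\<^sub>R a + u *\<^sub>R b"
    by (auto simp: in_segment)
  have "tail_sum idx (idx i) a \<in> {real (m (idx i))..real (m (idx i) + 1)} \<and>
        tail_sum idx (idx i) b \<in> {real (m (idx i))..real (m (idx i) + 1)}" for i
  proof -
    let ?t = "tail_sum idx (idx i)"
    have tx: "?t x = (1 - u) * ?t a + u * ?t b"
      unfolding u(3) by (simp add: linear_add[OF linear_tail_sum] linear_cmul[OF linear_tail_sum])
    have la: "real (l (idx i)) \<le> ?t a" "?t a \<le> real (l (idx i)) + 1"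
      and lb: "real (l (idx i)) \<le> ?t b" "?t b \<le> real (l (idx i)) + 1"
      and mx: "real (m (idx i)) \<le> ?t x" "?t x \<le> real (m (idx i)) + 1"
      using a b x by (auto simp: unit_cell_def tail_polytope_def algebra_simps)
    \<comment> \<open>The deviation of \<open>x\<close> from \<open>c\<close> is a weighted mean of
      those of \<open>a\<close> and \<open>b\<close>. When these have one sign and \<open>x\<close>
      deviates the other way or not at all, all three vanish.\<close>
    have sum0: "(1 - u) * (?t a - c) + u * (?t b - c) = ?t x - c" for c
      unfolding tx by (simp add: algebra_simps)
    consider "l (idx i) = m (idx i)" | "l (idx i) < m (idx i)" | "m (idx i) < l (idx i)" by linarith
    then show ?thesis
    proof cases
      case 1
      then show ?thesis using la lb by simp
    next
      case 2
      \<comment> \<open>The only value that the two intervals can share, namely the upper end of the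
        first; in the third case it is the lower end.\<close>
      let ?c = "real (l (idx i)) + 1"
      have c: "?c \<le> ?t x" using 2 mx by simp
      have "(1 - u) * (?t a - ?c) \<le> 0" "u * (?t b - ?c) \<le> 0"
        using la lb u by (simp_all add: mult_nonneg_nonpos)
      then have "(1 - u) * (?t a - ?c) = 0" "u * (?t b - ?c) = 0" using sum0[of ?c] c by linarith+
      then have "?t a = ?c" "?t b = ?c" using u by auto
      moreover have "?t x = ?c" using sum0[of ?c] \<open>(1 - u) * (?t a - ?c) = 0\<close> \<open>u * (?t b - ?c) = 0\<close> by linarith
      ultimately show ?thesis using mx by simp
    next
      case 3
      let ?c = "real (l (idx i))"
      have c: "?t x \<le> ?c" using 3 mx by simp
      have "(1 - u) * (?t a - ?c) \<ge> 0" "u * (?t b - ?c) \<ge> 0"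
        using la lb u by simp_all
      then have "(1 - u) * (?t a - ?c) = 0" "u * (?t b - ?c) = 0" using sum0[of ?c] c by linarith+
      then have "?t a = ?c" "?t b = ?c" using u by auto
      moreover have "?t x = ?c" using sum0[of ?c] \<open>(1 - u) * (?t a - ?c) = 0\<close> \<open>u * (?t b - ?c) = 0\<close> by linarith
      ultimately show ?thesis using mx by simp
    qed
  qed
  then show "a \<in> unit_cell idx l \<inter> unit_cell idx m" "b \<in> unit_cell idx l \<inter> unit_cell idx m"
    using a b by (auto simp: unit_cell_def tail_polytope_def)
qed auto

section \<open>Covering by the cells\<close>

lemma tail_polytope_cong:
  assumes "\<And>i. l (idx i) = l' (idx i)" "\<And>i. u (idx i) = u' (idx i)"
  shows "tail_polytope idx l u = tail_polytope idx l' u'"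
  using assms by (simp add: tail_polytope_def)

lemma tail_polytope_mono:
  assumes "\<And>i. l' (idx i) \<le> l (idx i)" "\<And>i. u (idx i) \<le> u' (idx i)"
  shows "tail_polytope idx l u \<subseteq> tail_polytope idx l' u'"
proof -
  have "{real (l (idx i))..real (u (idx i))} \<subseteq> {real (l' (idx i))..real (u' (idx i))}" for i
    using assms[of i] by simp
  then show ?thesis unfolding tail_polytope_def by blast
qed

lemma feasible_polytope_top_cell:
  assumes idx: "bij_betw idx UNIV {1..n}" and R: "R \<subseteq> {1..n}" and "n \<notin> R" and "n \<ge> 1"
  shows "feasible_polytope idx (gale_delta n R (R \<union> {n})) = unit_cell idx (tail_card R)"
proof -
  have "idx i \<le> n" for i using bij_betw_apply[OF idx UNIV_I, of i] by simp
  moreover have "R \<union> {n} \<subseteq> {1..n}" using R \<open>n \<ge> 1\<close> by auto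
  ultimately show ?thesis
    unfolding feasible_polytope_gale_delta[OF idx R \<open>R \<union> {n} \<subseteq> {1..n}\<close>] unit_cell_def
    using tail_card_insert_top[OF R \<open>n \<notin> R\<close>] by (intro tail_polytope_cong) auto
qed

text \<open>This keeps sequences of tail counts closed under pointwise minimum, so that truncated
  floors still come from a set.\<close>

lemma int_min_step: "a - a' \<in> {0, 1} \<Longrightarrow> b - b' \<in> {0, 1} \<Longrightarrow> min a b - min a' b' \<in> {0, 1 :: int}"
  by auto

text \<open>The cell containing \<open>x\<close> is found by rounding its tail sums down, and then
  truncating so as to stay below \<open>T - {n}\<close>.\<close>

lemma tail_polytope_covered:
  assumes idx: "bij_betw idx UNIV {1..n}" and U: "U \<subseteq> {1..n}" and n: "n \<notin> U"
    and S: "S \<subseteq> {1..n}" and le: "gale_le S U"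
    and x: "x \<in> tail_polytope idx (tail_card S) (tail_card (U \<union> {n}))"
  obtains R where "R \<subseteq> {1..n}" "gale_le S R" "gale_le R U" "x \<in> unit_cell idx (tail_card R)"
proof -
  have r: "range idx = {1..n}" "inj idx" using idx by (auto simp: bij_betw_def)
  have idx_in: "idx i \<in> {1..n}" for i using r(1) by blast
  have finU: "finite U" using U finite_subset by blast
  \<comment> \<open>For \<open>k\<close> in \<open>{1..n}\<close> truncation changes the floor only
    where the tail sum attains its upper bound \<open>tail_card U k + 1\<close>; there
    \<open>x\<close> lies on the top side of the chosen cell.\<close>
  define f where "f k = min \<lfloor>tail_sum idx k x\<rfloor> (int (tail_card U k))" for k
  have "f (Suc n) = 0"
    using r tail_card_eq_0[OF U] by (simp add: f_def tail_sum_eq_0[of idx n])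
  moreover have "f k - f (Suc k) \<in> {0, 1}" if k: "k \<in> {1..n}" for k
    unfolding f_def
  proof (rule int_min_step)
    show "int (tail_card U k) - int (tail_card U (Suc k)) \<in> {0, 1}"
      using tail_card_Suc[OF finU, of k] by auto
    obtain i where i: "k = idx i" using k r(1) by blast
    have "x $ i \<in> {0..1}" using x by (simp add: tail_polytope_def)
    \<comment> \<open>The two tail sums differ by \<open>x $ i\<close>, and adding a number from the
      unit interval raises a floor by 0 or 1.\<close>
    then show "\<lfloor>tail_sum idx k x\<rfloor> - \<lfloor>tail_sum idx (Suc k) x\<rfloor> \<in> {0, 1}"
      using tail_sum_Suc[OF r(2), of i x] by (auto simp: i) linarith+
  qed
  ultimately obtain R where R: "R \<subseteq> {1..n}" "\<And>k. k \<in> {1..Suc n} \<Longrightarrow> int (tail_card R k) = f k"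
    using ex_set_with_tail_cards by metis
  have x': "0 \<le> x $ i" "x $ i \<le> 1" "real (tail_card S (idx i)) \<le> tail_sum idx (idx i) x"
      "tail_sum idx (idx i) x \<le> real (tail_card U (idx i)) + 1" for i
  proof -
    have "real (tail_card (U \<union> {n}) (idx i)) = real (tail_card U (idx i)) + 1"
      using tail_card_insert_top[OF U n, of "idx i"] idx_in[of i] by simp
    then show "0 \<le> x $ i" "x $ i \<le> 1" "real (tail_card S (idx i)) \<le> tail_sum idx (idx i) x"
      "tail_sum idx (idx i) x \<le> real (tail_card U (idx i)) + 1"
      using x unfolding tail_polytope_def mem_Collect_eq atLeastAtMost_iff by metis+
  qed
  have fi: "int (tail_card R (idx i)) = f (idx i)" for i using R(2)[of "idx i"] idx_in[of i] by simp
  have SU: "tail_card S k \<le> tail_card U k" if "k \<in> {1..n}" for k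
    using le that gale_le_iff_tail_card_on[OF S U] by blast
  have "tail_card S k \<le> tail_card R k" if k: "k \<in> {1..n}" for k
  proof -
    obtain i where i: "k = idx i" using k r(1) by blast
    \<comment> \<open>An integer below the tail sum is below its floor, and \<open>SU\<close> bounds
      the other argument of the minimum.\<close>
    have "int (tail_card S k) \<le> f k"
      using x'(3)[of i] SU[OF k] by (simp add: f_def i le_floor_iff)
    then show ?thesis using fi[of i] i by simp
  qed
  moreover have "tail_card R k \<le> tail_card U k" if "k \<in> {1..n}" for k
    using R(2)[of k] that by (simp add: f_def)
  moreover have "x \<in> unit_cell idx (tail_card R)"
  proof -
    have "real (tail_card R (idx i)) \<le> tail_sum idx (idx i) x \<and>
          tail_sum idx (idx i) x \<le> real (tail_card R (idx i)) + 1" for i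
    proof -
      have "real (tail_card R (idx i)) = min (real_of_int \<lfloor>tail_sum idx (idx i) x\<rfloor>) (real (tail_card U (idx i)))"
        using fi[of i] unfolding f_def by linarith
      then show ?thesis using x'(4)[of i] by linarith
    qed
    then show ?thesis using x' by (simp add: unit_cell_def tail_polytope_def algebra_simps)
  qed
  ultimately show ?thesis
    using that R(1) gale_le_iff_tail_card_on[OF S R(1)] gale_le_iff_tail_card_on[OF R(1) U] by blast
qed

text \<open>Strictness at \<open>n\<close> forces \<open>n\<close> into \<open>T\<close>. Strictness
  at every index leaves room to lower all tail counts of \<open>T\<close> by one, which is the
  effect of removing \<open>n\<close>.\<close>

lemma linked_delta_top:
  assumes idx: "bij_betw idx UNIV {1..n}" and n: "n \<ge> 1" and S: "S \<subseteq> {1..n}" and T: "T \<subseteq> {1..n}"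
    and le: "gale_le S T" and linked: "linked_delta idx (gale_delta n S T)"
  shows "n \<in> T" "gale_le S (T - {n})"
proof -
  note less = linked_delta_tail_card_less[OF idx S T le linked]
  have T': "T - {n} \<subseteq> {1..n}" "finite T" using T finite_subset by blast+
  show "n \<in> T"
    using less[of n] n tail_card_Suc[OF T'(2), of n] tail_card_eq_0[OF T, of "Suc n"]
    by (auto split: if_splits intro: ccontr)
  then have "T - {n} \<union> {n} = T" by auto
  then show "gale_le S (T - {n})"
    using less tail_card_insert_top[OF T'(1)] by (simp add: gale_le_iff_tail_card_on[OF S T'(1)] less_Suc_eq_le)
qed

text \<open>Comparing tail counts at the index \<open>n\<close> decides this, since the tail of
  \<open>T - {n}\<close> there is empty.\<close>

lemma top_cell_not_mem:
  assumes R: "R \<subseteq> {1..n}" and T: "T \<subseteq> {1..n}" and "n \<ge> 1" and le: "gale_le R (T - {n})"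
  shows "n \<notin> R"
proof -
  have T': "T - {n} \<subseteq> {1..n}" "finite (T - {n})" "finite R" using R T finite_subset by blast+
  have "tail_card R n \<le> tail_card (T - {n}) n"
    using le gale_le_iff_tail_card_on[OF R T'(1)] \<open>n \<ge> 1\<close> by simp
  also have "\<dots> = 0"
    using tail_card_Suc[OF T'(2), of n] tail_card_eq_0[OF T'(1), of "Suc n"] by simp
  finally show ?thesis using tail_card_Suc[OF T'(3), of n] by auto
qed

text \<open>Every cell fits into the box because raising the bound given by \<open>T - {n}\<close>
  by one yields the bound given by \<open>T\<close>. The other inclusion is the rounding
  argument.\<close>

lemma gale_delta_union:
  assumes idx: "bij_betw idx UNIV {1..n}" and n: "n \<ge> 1" and S: "S \<subseteq> {1..n}" and T: "T \<subseteq> {1..n}"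
    and le: "gale_le S T" and linked: "linked_delta idx (gale_delta n S T)"
  shows "feasible_polytope idx (gale_delta n S T) =
       (\<Union>R\<in>{R. R \<subseteq> {1..n} \<and> gale_le S R \<and> gale_le R (T - {n})}.
          feasible_polytope idx (gale_delta n R (R \<union> {n})))"
proof -
  note top = linked_delta_top[OF assms]
  have T': "T - {n} \<subseteq> {1..n}" "T - {n} \<union> {n} = T" using T top(1) by auto
  have idx_in: "idx i \<in> {1..n}" for i using bij_betw_apply[OF idx UNIV_I] .
  have cell: "feasible_polytope idx (gale_delta n R (R \<union> {n})) = unit_cell idx (tail_card R)"
    if "R \<subseteq> {1..n}" "gale_le R (T - {n})" for R
    using feasible_polytope_top_cell[OF idx that(1) top_cell_not_mem[OF that(1) T n that(2)] n] .
  have "unit_cell idx (tail_card R) \<subseteq> tail_polytope idx (tail_card S) (tail_card T)"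
    if R: "R \<subseteq> {1..n}" "gale_le S R" "gale_le R (T - {n})" for R
  proof -
    have "tail_card S k \<le> tail_card R k" "tail_card R k + 1 \<le> tail_card T k" if "k \<in> {1..n}" for k
      using R that gale_le_iff_tail_card_on[OF S R(1)] gale_le_iff_tail_card_on[OF R(1) T'(1)]
        tail_card_insert_top[OF T'(1), of k] T'(2) by auto
    then have "tail_card S (idx i) \<le> tail_card R (idx i)" "tail_card R (idx i) + 1 \<le> tail_card T (idx i)" for i
      using idx_in by blast+
    then show ?thesis
      unfolding unit_cell_def by (intro tail_polytope_mono)
  qed
  moreover have "\<exists>R. R \<subseteq> {1..n} \<and> gale_le S R \<and> gale_le R (T - {n}) \<and> x \<in> unit_cell idx (tail_card R)"
    if "x \<in> tail_polytope idx (tail_card S) (tail_card T)" for x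
    by (rule tail_polytope_covered[OF idx T'(1) _ S top(2), unfolded T'(2), OF _ that]) blast+
  ultimately show ?thesis
    unfolding feasible_polytope_gale_delta[OF idx S T] using cell by auto
qed

lemma polytope_feasible_polytope: "finite (feasible D) \<Longrightarrow> polytope (feasible_polytope idx D)"
  unfolding feasible_polytope_def polytope_def by blast

text \<open>The sets \<open>R\<close> are forgotten once the cells are known to be unit cells,
  because the face property depends only on the bounds being integers.\<close>

lemma gale_delta_subdivision:
  assumes idx: "bij_betw idx UNIV {1..n}" and n: "n \<ge> 1" and S: "S \<subseteq> {1..n}" and T: "T \<subseteq> {1..n}"
    and le: "gale_le S T" and linked: "linked_delta idx (gale_delta n S T)"
  shows "polytope_subdivision (feasible_polytope idx (gale_delta n S T))
       ((\<lambda>R. feasible_polytope idx (gale_delta n R (R \<union> {n}))) `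
          {R. R \<subseteq> {1..n} \<and> gale_le S R \<and> gale_le R (T - {n})})"
proof -
  let ?I = "{R. R \<subseteq> {1..n} \<and> gale_le S R \<and> gale_le R (T - {n})}"
  let ?F = "(\<lambda>R. feasible_polytope idx (gale_delta n R (R \<union> {n}))) ` ?I"
  have cell: "X \<in> range (unit_cell idx)" if "X \<in> ?F" for X
    using that feasible_polytope_top_cell[OF idx _ top_cell_not_mem[OF _ T n] n] by blast
  have "finite ?F" by (rule finite_imageI, rule finite_subset[of _ "Pow {1..n}"]) auto
  moreover have "polytope (feasible_polytope idx (gale_delta n A B))" for A B
    by (rule polytope_feasible_polytope) (simp add: feasible_def gale_delta_def)
  then have "\<forall>X\<in>?F. polytope X" by (intro ballI) (elim imageE, simp only:)
  moreover have "\<forall>X\<in>?F. \<forall>Y\<in>?F. X \<inter> Y face_of X \<and> X \<inter> Y face_of Y"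
  proof (intro ballI)
    fix X Y assume "X \<in> ?F" "Y \<in> ?F"
    from cell[OF this(1)] cell[OF this(2)]
    obtain l m where "X = unit_cell idx l" "Y = unit_cell idx m" by (elim rangeE)
    then show "X \<inter> Y face_of X \<and> X \<inter> Y face_of Y"
      using unit_cell_Int_face[of idx l m] unit_cell_Int_face[of idx m l] by (simp add: Int_commute)
  qed
  ultimately show ?thesis
    unfolding polytope_subdivision_def gale_delta_union[OF assms] by (intro conjI refl)
qed

section \<open>Symmetric paths\<close>

text \<open>The time \<open>k\<close> is the sum of the two coordinates reached, so this number and
  \<open>k\<close> determine the point, and paths can be compared at equal times.\<close>

definition east_count :: "lattice_path \<Rightarrow> nat \<Rightarrow> nat" where
  "east_count p k = count_list (take k p) East"

lemma count_list_East_add_North: "count_list p East + count_list p North = length p"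
proof (induction p)
  case (Cons s p)
  then show ?case by (cases s) auto
qed simp

lemma point_after_eq:
  assumes "k \<le> length p"
  shows "point_after p k = (east_count p k, k - east_count p k)" "east_count p k \<le> k"
  using count_list_East_add_North[of "take k p"] assms
  by (auto simp: point_after_def east_count_def)

lemma east_count_0 [simp]: "east_count p 0 = 0"
  by (simp add: east_count_def)

lemma east_count_Suc:
  "k < length p \<Longrightarrow> east_count p (Suc k) = east_count p k + of_bool (p ! k = East)"
  by (simp add: east_count_def take_Suc_conv_app_nth)

lemma east_count_mono:
  assumes "j \<le> k" "k \<le> length p"
  shows "east_count p j \<le> east_count p k"
  using assms
proof (induction rule: inc_induct)
  case (step m)
  then show ?case using east_count_Suc[of m p] by simp
qed simp

text \<open>The count grows by at most one per step and so skips no value: a discrete intermediate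
  value argument.\<close>

lemma east_count_attains:
  assumes "k \<le> length p" "east_count p k \<le> x" "x \<le> east_count p (length p)"
  shows "\<exists>j\<in>{k..length p}. east_count p j = x"
  using assms
proof (induction rule: inc_induct)
  case base
  then show ?case by simp
next
  case (step m)
  show ?case
  proof (cases "east_count p m = x")
    case True
    then show ?thesis using step.hyps by (intro bexI[of _ m]) simp_all
  next
    case False
    then have "east_count p (Suc m) \<le> x"
      using step.hyps step.prems east_count_Suc[of m p] by simp
    then obtain j where "j \<in> {Suc m..length p}" "east_count p j = x"
      using step.IH step.prems by blast
    then show ?thesis by (intro bexI[of _ j]) simp_all
  qed
qed

text \<open>At equal times the lower path is further east. The hypothesis on the ends lets
  \<open>q\<close> reach every column that \<open>p\<close> visits.\<close>

lemma path_le_iff_east_count: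
  assumes len: "length p = length q" and ends: "east_count p (length p) \<le> east_count q (length q)"
  shows "path_le p q \<longleftrightarrow> (\<forall>k\<le>length p. east_count q k \<le> east_count p k)"
proof
  assume le: "path_le p q"
  show "\<forall>k\<le>length p. east_count q k \<le> east_count p k"
  proof (intro allI impI)
    fix k assume k: "k \<le> length p"
    have "(east_count p k, k - east_count p k) \<in> path_points p"
      using point_after_eq(1)[OF k] k unfolding path_points_def by force
    then obtain y where y: "y \<ge> k - east_count p k" "(east_count p k, y) \<in> path_points q"
      using le unfolding path_le_def by blast
    then obtain j where j: "j \<le> length q" "point_after q j = (east_count p k, y)"
      by (auto simp: path_points_def)
    have "east_count q j = east_count p k" "y = j - east_count q j" "east_count q j \<le> j"
      using point_after_eq[OF j(1)] j(2) by simp_all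
    \<comment> \<open>In the same column \<open>q\<close> is at least as high as \<open>p\<close>,
      hence it gets there no earlier.\<close>
    moreover have "k \<le> j" using calculation y(1) by linarith
    ultimately show "east_count q k \<le> east_count p k"
      using east_count_mono[of k j q] j(1) by simp
  qed
next
  assume le: "\<forall>k\<le>length p. east_count q k \<le> east_count p k"
  show "path_le p q"
    unfolding path_le_def
  proof (rule ballI, clarify)
    fix x y assume "(x, y) \<in> path_points p"
    then obtain k where k: "k \<le> length p" "point_after p k = (x, y)"
      by (auto simp: path_points_def)
    then have xy: "x = east_count p k" "y = k - east_count p k"
      using point_after_eq(1)[OF k(1)] by auto
    have "east_count q k \<le> x" using le k xy by blast
    moreover have "x \<le> east_count q (length q)"
      using east_count_mono[of k "length p" p] k(1) ends xy by simp
    \<comment> \<open>\<open>q\<close> lags behind in East steps, so it visits the column at some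
      time \<open>j\<close> no earlier than \<open>k\<close> and is then at least as high as
      \<open>p\<close>.\<close>
    ultimately obtain j where j: "j \<in> {k..length q}" "east_count q j = x"
      using east_count_attains[of k q x] k(1) len by auto
    then have "(x, j - x) \<in> path_points q"
      using point_after_eq(1)[of j q] unfolding path_points_def by force
    moreover have "y \<le> j - x" using j xy by auto
    ultimately show "\<exists>y'\<ge>y. (x, y') \<in> path_points q" by blast
  qed
qed

section \<open>Label sets of symmetric paths\<close>

definition path_set :: "nat \<Rightarrow> lattice_path \<Rightarrow> nat set" where
  "path_set n r = {i\<in>{1..n}. int i \<in> labL n r}"

lemma path_set_subset: "path_set n r \<subseteq> {1..n}"
  by (auto simp: path_set_def)

text \<open>The label 0 is skipped, so the positive labels begin with 1 at step \<open>n\<close>,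
  counted from 0.\<close>

lemma Suc_mem_path_set:
  assumes "length r = 2 * n" "i < n"
  shows "Suc i \<in> path_set n r \<longleftrightarrow> r ! (n + i) = East"
proof -
  have "int (Suc i) = step_label n k \<longleftrightarrow> k = n + i" for k
    by (auto simp: step_label_def)
  then show ?thesis using assms by (simp add: path_set_def labL_def)
qed

text \<open>The \<open>2 * k\<close> steps around the middle form \<open>k\<close> mirror pairs,
  each with exactly one East step.\<close>

lemma antisymmetric_east_count:
  assumes len: "length r = 2 * n" and anti: "\<forall>i<n. r ! i \<noteq> r ! (2 * n - 1 - i)" and "k \<le> n"
  shows "east_count r (n + k) = east_count r (n - k) + k"
  using \<open>k \<le> n\<close>
proof (induction k)
  case (Suc k)
  \<comment> \<open>Widening the window by one step on each side adds one mirror pair, the steps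
    \<open>n - Suc k\<close> and \<open>n + k\<close>.\<close>
  then have e: "n - k = Suc (n - Suc k)" "2 * n - 1 - (n - Suc k) = n + k" by auto
  have "r ! (n - Suc k) \<noteq> r ! (n + k)"
    using anti[rule_format, of "n - Suc k"] Suc.prems unfolding e(2) by simp
  then have "of_bool (r ! (n - Suc k) = East) + of_bool (r ! (n + k) = East) = (1 :: nat)"
    by (cases "r ! (n - Suc k)"; cases "r ! (n + k)") auto
  moreover have "east_count r (Suc (n + k)) = east_count r (n + k) + of_bool (r ! (n + k) = East)"
    using Suc.prems len by (intro east_count_Suc) simp
  moreover have "east_count r (n - k) = east_count r (n - Suc k) + of_bool (r ! (n - Suc k) = East)"
    unfolding e(1) using Suc.prems len by (intro east_count_Suc) simp
  ultimately show ?case using Suc by simp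
qed simp

lemma symmetric_path_iff:
  "symmetric_path n r \<longleftrightarrow> length r = 2 * n \<and> (\<forall>i<n. r ! i \<noteq> r ! (2 * n - 1 - i))"
proof -
  have "point_after r (2 * n) = (n, n)"
    if "length r = 2 * n" "\<forall>i<n. r ! i \<noteq> r ! (2 * n - 1 - i)"
    \<comment> \<open>For \<open>k = n\<close> the window is the whole path, so \<open>n\<close> of
      its \<open>2 * n\<close> steps go East.\<close>
    using antisymmetric_east_count[OF that, of n] point_after_eq(1)[of "2 * n" r] that(1)
    by (simp flip: mult_2)
  then show ?thesis unfolding symmetric_path_def by blast
qed

text \<open>The East steps after time \<open>n + k\<close> carry the labels above \<open>k\<close>,
  and there are \<open>n\<close> East steps in all; pairing mirror steps gives the second equation.
  Sums avoid truncated subtraction.\<close>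

lemma symmetric_path_east_count:
  assumes r: "symmetric_path n r" and k: "k \<le> n"
  shows "east_count r (n + k) + tail_card (path_set n r) (Suc k) = n"
    and "east_count r (n - k) + tail_card (path_set n r) (Suc k) + k = n"
proof -
  have len: "length r = 2 * n" and anti: "\<forall>i<n. r ! i \<noteq> r ! (2 * n - 1 - i)"
    using r unfolding symmetric_path_iff by blast+
  have fin: "finite (path_set n r)" by (rule finite_subset[OF path_set_subset]) simp
  show 1: "east_count r (n + k) + tail_card (path_set n r) (Suc k) = n"
    using k
  proof (induction rule: inc_induct)
    case base
    show ?case
      using antisymmetric_east_count[OF len anti, of n] tail_card_eq_0[OF path_set_subset, of n "Suc n"]
      by simp
  next
    case (step m)
    have "east_count r (Suc (n + m)) = east_count r (n + m) + of_bool (r ! (n + m) = East)"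
      using step.hyps len by (intro east_count_Suc) simp
    then show ?case
      using step.IH tail_card_Suc[OF fin, of "Suc m"] Suc_mem_path_set[OF len step.hyps(2)] by simp
  qed
  show "east_count r (n - k) + tail_card (path_set n r) (Suc k) + k = n"
    using 1 antisymmetric_east_count[OF len anti k] by simp
qed

lemma symmetric_path_times:
  fixes t n :: nat
  assumes "t \<le> 2 * n"
  obtains k where "k \<le> n" "t = n + k" | k where "k \<le> n" "t = n - k"
proof (cases "n \<le> t")
  case True
  then show ?thesis using that(1)[of "t - n"] assms by simp
next
  case False
  then show ?thesis using that(2)[of "n - t"] by simp
qed

text \<open>On both sides of the mirror line the East count is a constant minus a tail count of the
  label set, so fewer East steps mean larger tail counts.\<close>

lemma symmetric_path_le_iff:
  assumes p: "symmetric_path n p" and q: "symmetric_path n q"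
  shows "path_le p q \<longleftrightarrow> gale_le (path_set n p) (path_set n q)"
proof -
  have len: "length p = 2 * n" "length q = 2 * n" using p q by (simp_all add: symmetric_path_def)
  note ep = symmetric_path_east_count[OF p] and eq = symmetric_path_east_count[OF q]
  have "east_count p (2 * n) = east_count q (2 * n)"
    using ep(1)[of n] eq(1)[of n] tail_card_eq_0[OF path_set_subset, of n "Suc n"] by (simp add: mult_2)
  then have "path_le p q \<longleftrightarrow> (\<forall>t\<le>2 * n. east_count q t \<le> east_count p t)"
    using path_le_iff_east_count[of p q] len by simp
  also have "\<dots> \<longleftrightarrow> (\<forall>k\<le>n. tail_card (path_set n p) (Suc k) \<le> tail_card (path_set n q) (Suc k))"
  proof (intro iffI allI impI)
    fix k assume "\<forall>t\<le>2 * n. east_count q t \<le> east_count p t" and k: "k \<le> n"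
    then have "east_count q (n + k) \<le> east_count p (n + k)" by simp
    then show "tail_card (path_set n p) (Suc k) \<le> tail_card (path_set n q) (Suc k)"
      using ep(1)[OF k] eq(1)[OF k] by linarith
  next
    fix t assume le: "\<forall>k\<le>n. tail_card (path_set n p) (Suc k) \<le> tail_card (path_set n q) (Suc k)"
      and "t \<le> 2 * n"
    from this(2) show "east_count q t \<le> east_count p t"
    proof (cases rule: symmetric_path_times)
      case (1 k)
      show ?thesis unfolding 1(2) using ep(1)[OF 1(1)] eq(1)[OF 1(1)] le[rule_format, OF 1(1)] by linarith
    next
      case (2 k)
      show ?thesis unfolding 2(2) using ep(2)[OF 2(1)] eq(2)[OF 2(1)] le[rule_format, OF 2(1)] by linarith
    qed
  qed
  also have "\<dots> \<longleftrightarrow> (\<forall>k\<in>{1..n}. tail_card (path_set n p) k \<le> tail_card (path_set n q) k)"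
  proof (intro iffI allI ballI impI)
    fix k assume "\<forall>k\<le>n. tail_card (path_set n p) (Suc k) \<le> tail_card (path_set n q) (Suc k)" "k \<in> {1..n}"
    then show "tail_card (path_set n p) k \<le> tail_card (path_set n q) k"
      by (cases k) simp_all
  next
    fix k assume le: "\<forall>k\<in>{1..n}. tail_card (path_set n p) k \<le> tail_card (path_set n q) k" and k: "k \<le> n"
    show "tail_card (path_set n p) (Suc k) \<le> tail_card (path_set n q) (Suc k)"
    proof (cases "k = n")
      case True
      then show ?thesis by (simp add: tail_card_eq_0[OF path_set_subset])
    qed (use le k in simp)
  qed
  finally show ?thesis by (simp add: gale_le_iff_tail_card_on[OF path_set_subset path_set_subset])
qed

text \<open>The second half spells out \<open>A\<close>. The first half is forced by symmetry: step
  \<open>k\<close> is the mirror image of the step labelled \<open>n - k\<close>.\<close>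

definition path_of :: "nat \<Rightarrow> nat set \<Rightarrow> lattice_path" where
  "path_of n A = map (\<lambda>k. if (if k < n then n - k \<notin> A else Suc (k - n) \<in> A) then East else North) [0..<2 * n]"

lemma symmetric_path_of: "symmetric_path n (path_of n A)"
  by (auto simp: symmetric_path_iff path_of_def Suc_diff_Suc)

lemma path_set_path_of:
  assumes "A \<subseteq> {1..n}"
  shows "path_set n (path_of n A) = A"
proof (rule set_eqI)
  fix i
  show "i \<in> path_set n (path_of n A) \<longleftrightarrow> i \<in> A"
  proof (cases "i \<in> {1..n}")
    case True
    then obtain j where j: "i = Suc j" "j < n" by (cases i) auto
    have "length (path_of n A) = 2 * n" by (simp add: path_of_def)
    then show ?thesis unfolding j(1) using Suc_mem_path_set[of "path_of n A" n j] j(2)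
      by (simp add: path_of_def)
  next
    case False
    then show ?thesis using assms path_set_subset[of n "path_of n A"] by blast
  qed
qed

text \<open>Passing to label sets turns the path order into the Gale order, and
  \<open>path_of\<close> provides a path for every subset.\<close>

lemma path_delta_path_of:
  assumes A: "A \<subseteq> {1..n}" and B: "B \<subseteq> {1..n}"
  shows "path_delta n (path_of n A) (path_of n B) = gale_delta n A B"
proof -
  have "{path_set n r | r. symmetric_path n r \<and> path_le (path_of n A) r \<and> path_le r (path_of n B)} =
    {R. R \<subseteq> {1..n} \<and> gale_le A R \<and> gale_le R B}" (is "?L = ?R")
  proof (rule set_eqI, rule iffI)
    fix R assume "R \<in> ?L"
    then obtain r where r: "R = path_set n r" "symmetric_path n r"
      "path_le (path_of n A) r" "path_le r (path_of n B)" by blast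
    have "gale_le A R" "gale_le R B"
      using r symmetric_path_le_iff[OF symmetric_path_of r(2), of A]
        symmetric_path_le_iff[OF r(2) symmetric_path_of, of B]
        path_set_path_of[OF A] path_set_path_of[OF B] by simp_all
    then show "R \<in> ?R" unfolding r(1) using path_set_subset by blast
  next
    fix R assume R: "R \<in> ?R"
    then have "path_set n (path_of n R) = R" by (simp add: path_set_path_of)
    moreover have "path_le (path_of n A) (path_of n R)" "path_le (path_of n R) (path_of n B)"
      using R symmetric_path_le_iff[OF symmetric_path_of symmetric_path_of] path_set_path_of[OF A]
        path_set_path_of[OF B] calculation by simp_all
    ultimately show "R \<in> ?L" using symmetric_path_of by blast
  qed
  then show ?thesis by (simp add: path_delta_def gale_delta_def path_set_def)
qed

section \<open>Snakes from paths one diagonal step apart\<close>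

lemma point_after_eq_iff:
  assumes "j \<le> length p" "k \<le> length q"
  shows "point_after p j = point_after q k \<longleftrightarrow> j = k \<and> east_count p j = east_count q k"
  using point_after_eq[OF assms(1)] point_after_eq[OF assms(2)] by auto

text \<open>The boxes \<open>(a, b + 1)\<close> and \<open>(a + 1, b)\<close> of a square lie on one
  antidiagonal and would put the paths two diagonal steps apart. A common point is reached by both
  paths at the same time, so the East counts agree there.\<close>

lemma snake_of_east_count:
  assumes p: "symmetric_path n p" and q: "symmetric_path n q"
    and step: "\<And>t. 0 < t \<Longrightarrow> t < 2 * n \<Longrightarrow> east_count p t = Suc (east_count q t)"
  shows "symmetric_snake n p q" "linked_paths n p q"
proof -
  have len: "length p = 2 * n" "length q = 2 * n"
    and ends: "point_after p (2 * n) = (n, n)" "point_after q (2 * n) = (n, n)"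
    using p q by (simp_all add: symmetric_path_def)
  have start: "point_after p 0 = (0, 0)" "point_after q 0 = (0, 0)"
    by (simp_all add: point_after_def)
  have e: "east_count p (2 * n) = n" "east_count q (2 * n) = n"
    using ends point_after_eq(1)[of "2 * n" p] point_after_eq(1)[of "2 * n" q] len by simp_all
  \<comment> \<open>The paths coincide at times 0 and \<open>2 * n\<close>, so the gap is 0 or 1
    throughout.\<close>
  have close: "east_count q t \<le> east_count p t" "east_count p t \<le> Suc (east_count q t)" if "t \<le> 2 * n" for t
    using step[of t] e that by (cases "t = 0"; cases "t = 2 * n"; simp)+
  have "path_le p q" using path_le_iff_east_count[of p q] len e close by simp
  moreover have False if sq: "(a, b + 1) \<in> skew_diagram p q" "(a + 1, b) \<in> skew_diagram p q" for a b
  proof -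
    obtain h where h: "east_step_from p (a + 1, h)" "h \<le> b" using sq(2) unfolding skew_diagram_def by blast
    obtain h' where h': "east_step_from q (a, h')" "b + 2 \<le> h'" using sq(1) unfolding skew_diagram_def by auto
    obtain i where i: "i < 2 * n" "p ! i = East" "point_after p i = (a + 1, h)"
      using h(1) len unfolding east_step_from_def by auto
    obtain j where j: "j < 2 * n" "point_after q j = (a, h')"
      using h'(1) len unfolding east_step_from_def by auto
    have pi: "east_count p i = a + 1" "i = a + 1 + h"
      using i point_after_eq[of i p] len by auto
    have qj: "east_count q j = a" "j = a + h'"
      using j point_after_eq[of j q] len by auto
    \<comment> \<open>\<open>p\<close> takes its East step out of column \<open>a + 1\<close> at
      height at most \<open>b\<close>, hence before \<open>q\<close>, at height at least
      \<open>b + 2\<close>, leaves column \<open>a\<close>. Right after the step of \<open>p\<close>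
      the gap is at least two.\<close>
    have "Suc i \<le> j" using pi qj h(2) h'(2) by simp
    have "east_count p (Suc i) = a + 2" using east_count_Suc[of i p] i len pi by simp
    moreover have "east_count q (Suc i) \<le> a" using east_count_mono[OF \<open>Suc i \<le> j\<close>, of q] j(1) len qj by simp
    ultimately show False using close(2)[of "Suc i"] i(1) by simp
  qed
  then have "\<not> (\<exists>a b. {(a, b), (a + 1, b), (a, b + 1), (a + 1, b + 1)} \<subseteq> skew_diagram p q)"
    unfolding insert_subset by blast
  ultimately show "symmetric_snake n p q" unfolding symmetric_snake_def using p q by blast
  show "linked_paths n p q"
    unfolding linked_paths_def
  proof (rule subset_antisym; rule subsetI)
    fix v assume "v \<in> path_points p \<inter> path_points q"
    then obtain s t where st: "s \<le> 2 * n" "v = point_after p s" "t \<le> 2 * n" "v = point_after q t"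
      using len by (auto simp: path_points_def)
    then have "s = t" "east_count p t = east_count q t"
      using point_after_eq_iff[of s p t q] len by auto
    then have "t = 0 \<or> t = 2 * n" using step[of t] st(3) by force
    then show "v \<in> {(0, 0), (n, n)}" using start ends st(4) by auto
  next
    fix v assume "v \<in> {(0, 0), (n, n)}"
    then have "v \<in> {point_after p 0, point_after p (2 * n)}" "v \<in> {point_after q 0, point_after q (2 * n)}"
      using start ends by simp_all
    then show "v \<in> path_points p \<inter> path_points q" unfolding path_points_def len by auto
  qed
qed

text \<open>The tail counts of \<open>R\<close> and \<open>R \<union> {n}\<close> differ by one up
  to index \<open>n\<close>, which is a gap of one East step at every time except the two
  ends.\<close>

lemma top_cell_is_snake:
  assumes R: "R \<subseteq> {1..n}" and "n \<notin> R" and n: "n \<ge> 1"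
  shows "\<exists>p q. symmetric_snake n p q \<and> linked_paths n p q \<and> gale_delta n R (R \<union> {n}) = path_delta n p q"
proof -
  have R': "R \<union> {n} \<subseteq> {1..n}" using R n by simp
  let ?p = "path_of n R" and ?q = "path_of n (R \<union> {n})"
  note ep = symmetric_path_east_count[OF symmetric_path_of[of n R], unfolded path_set_path_of[OF R]]
  note eq = symmetric_path_east_count[OF symmetric_path_of[of n "R \<union> {n}"], unfolded path_set_path_of[OF R']]
  have tail: "tail_card (R \<union> {n}) (Suc k) = tail_card R (Suc k) + 1" if "k < n" for k
    using tail_card_insert_top[OF R \<open>n \<notin> R\<close>, of "Suc k"] that by simp
  have "east_count ?p t = Suc (east_count ?q t)" if "0 < t" "t < 2 * n" for t
  proof -
    from that(2) have "t \<le> 2 * n" by simp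
    then show ?thesis
    proof (cases rule: symmetric_path_times)
      case (1 k)
      \<comment> \<open>A time strictly between the ends excludes \<open>k = n\<close>, where both
        tail counts at \<open>Suc n\<close> are 0 and the gap closes.\<close>
      then have "k < n" using that by simp
      then show ?thesis unfolding 1(2) using ep(1)[OF 1(1)] eq(1)[OF 1(1)] tail[of k] by linarith
    next
      case (2 k)
      then have "k < n" using that by simp
      then show ?thesis unfolding 2(2) using ep(2)[OF 2(1)] eq(2)[OF 2(1)] tail[of k] by linarith
    qed
  qed
  then have "symmetric_snake n ?p ?q" "linked_paths n ?p ?q"
    using snake_of_east_count[OF symmetric_path_of symmetric_path_of, of n R "R \<union> {n}"] by blast+
  then show ?thesis using path_delta_path_of[OF R R'] by metis
qed

theorem theorem6p1:
  fixes n :: nat and idx :: "'n::finite \<Rightarrow> nat" and S T :: "nat set"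
  assumes idx: "bij_betw idx UNIV {1..n}"
    and n: "n \<ge> 1"
    and S: "S \<subseteq> {1..n}"
    and T: "T \<subseteq> {1..n}"
    and le: "gale_le S T"
    and linked: "linked_delta idx (gale_delta n S T)"
  shows
    "feasible_polytope idx (gale_delta n S T) =
       (\<Union>R\<in>{R. R \<subseteq> {1..n} \<and> gale_le S R \<and> gale_le R (T - {n})}.
          feasible_polytope idx (gale_delta n R (R \<union> {n}))) \<and>
     polytope_subdivision (feasible_polytope idx (gale_delta n S T))
       ((\<lambda>R. feasible_polytope idx (gale_delta n R (R \<union> {n}))) `
          {R. R \<subseteq> {1..n} \<and> gale_le S R \<and> gale_le R (T - {n})}) \<and>
     (\<forall>R. R \<subseteq> {1..n} \<and> gale_le S R \<and> gale_le R (T - {n}) \<longrightarrow>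
        (\<exists>p q. symmetric_snake n p q \<and> linked_paths n p q \<and>
               gale_delta n R (R \<union> {n}) = path_delta n p q))"
  using gale_delta_union[OF assms] gale_delta_subdivision[OF assms]
    top_cell_is_snake[OF _ top_cell_not_mem[OF _ T n] n] by blast

end
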